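(* Let $K$ be a field which is not algebraically closed. Then $K$ has the minimal linear matching property, i.e. there exists a finite field extension $L$ of $K$ such that $L$ has the linear matching property from $K$.
   Context: Standing convention: field extensions $K\subset L$ are considered where $K$ is commutative and central in $L$. A finite extension is one with $[L:K]$ finite. Matched bases: Let $K\subset L$ be a field extension and let $A,B$ be $n$-dimensional $K$-subspaces of $L$. Let $\mathcal A=\{a_1,\ldots,a_n\}$ and $\mathcal B=\{b_1,\ldots,b_n\}$ be bases of $A$ and $B$ respectively. The basis $\mathcal A$ is matched to $\mathcal B$ if for all $b\in B$ and all $i=1,\ldots,n$, $$a_i b\in A \ \Rightarrow\ b\in\langle b_1,\ldots,\hat{b_i},\ldots,b_n\rangle,$$ where $\langle b_1,\ldots,\hat{b_i},\ldots,b_n\rangle$ is the hyperplane of $B$ spanned over $K$ by $\mathcal B\setminus\{b_i\}$. Matched subspaces: $A$ is matched to $B$ if every basis of $A$ can be matched to some basis of $B$. Linear matching property: $L$ has the linear matching property from $K$ if, for every $n\geq 1$ and all $n$-dimensional $K$-subspaces $A$ and $B$ of $L$ with $1\notin B$, the subspace $A$ is matched to $B$. Minimal linear matching property: a field $K$ has the minimal linear matching property if there exists a finite field extension $L$ of $K$ such that $L$ has the linear matching property from $K$. *)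

theory Defs
  imports "HOL-Algebra.Algebraic_Closure"
begin

text \<open>
  In the locale \<open>ring\<close> below, the ambient ring \<open>R\<close> is the top field \<open>L\<close> and \<open>K\<close> is a subset of its
  carrier, meant to be a (central) subfield. Bases are ordered, as lists.
\<close>

definition (in ring) basis_of :: "'a set \<Rightarrow> 'a set \<Rightarrow> 'a list \<Rightarrow> bool"
  where "basis_of K E Us \<longleftrightarrow> independent K Us \<and> Span K Us = E"

text \<open>\<open>take i Bs @ drop (Suc i) Bs\<close> is \<open>Bs\<close> with its entry at position \<open>i\<close> (counted from 0) removed.\<close>

definition (in ring) matched_bases ::
    "'a set \<Rightarrow> 'a set \<Rightarrow> 'a set \<Rightarrow> 'a list \<Rightarrow> 'a list \<Rightarrow> bool"
  where "matched_bases K A B As Bs \<longleftrightarrow>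
    (\<forall>b \<in> B. \<forall>i < length As.
       As ! i \<otimes> b \<in> A \<longrightarrow> b \<in> Span K (take i Bs @ drop (Suc i) Bs))"

definition (in ring) matched_subspaces :: "'a set \<Rightarrow> 'a set \<Rightarrow> 'a set \<Rightarrow> bool"
  where "matched_subspaces K A B \<longleftrightarrow>
    (\<forall>As. basis_of K A As \<longrightarrow> (\<exists>Bs. basis_of K B Bs \<and> matched_bases K A B As Bs))"

text \<open>For a subfield \<open>K\<close>, \<open>dimension n K A\<close> says that \<open>A\<close> is an \<open>n\<close>-dimensional \<open>K\<close>-subspace of
  the carrier.\<close>

definition (in ring) linear_matching_property :: "'a set \<Rightarrow> bool"
  where "linear_matching_property K \<longleftrightarrow>
    (\<forall>n \<ge> 1. \<forall>A B. dimension n K A \<and> dimension n K B \<and> \<one> \<notin> B \<longrightarrow> matched_subspaces K A B)"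

text \<open>An extension \<open>L\<close> of \<open>K\<close> is given by its embedding \<open>h\<close>; ring homomorphisms between fields are
  injective, so \<open>h ` carrier K\<close> is the copy of \<open>K\<close> inside \<open>L\<close>.\<close>

definition finite_field_extension ::
    "('a, 'm) ring_scheme \<Rightarrow> ('a \<Rightarrow> 'b) \<Rightarrow> ('b, 'n) ring_scheme \<Rightarrow> bool"
  where "finite_field_extension K h L \<longleftrightarrow>
    field K \<and> field L \<and> h \<in> ring_hom K L \<and> ring.finite_dimension L (h ` carrier K) (carrier L)"

text \<open>
  The extension is required to be proper: the only nonzero \<open>K\<close>-subspace of \<open>K\<close> is \<open>K\<close> itself, which
  contains \<open>1\<close>, so that \<open>K\<close> has the linear matching property from itself vacuously, and dropping
  \<open>h ` carrier K \<noteq> carrier L\<close> would make the property hold for every field.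

  The existential quantifier needs a fixed type for the elements of \<open>L\<close>. The type \<open>'a list set\<close>
  (that of the quotients \<open>K[X]/(p)\<close> in the library) loses no generality: an extension of degree \<open>n\<close>
  is in bijection with the lists of length \<open>n\<close> over \<open>K\<close> and so has an isomorphic copy in this type.
\<close>

definition minimal_linear_matching_property :: "('a, 'm) ring_scheme \<Rightarrow> bool"
  where "minimal_linear_matching_property K \<longleftrightarrow>
    (\<exists>(L :: 'a list set ring) h.
       finite_field_extension K h L \<and>
       h ` carrier K \<noteq> carrier L \<and>
       ring.linear_matching_property L (h ` carrier K))"

end

theory Submission
  imports Defs
begin

text \<open>
  Let \<open>p\<close> be irreducible over \<open>K\<close> of minimal degree greater than 1 and \<open>L = K[X]/(p)\<close>. An element of
  \<open>L\<close> outside \<open>K\<close> has an irreducible minimal polynomial of degree at least 2, hence at least \<open>deg p\<close>,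
  so it generates \<open>L\<close>.

  For such an \<open>L\<close> the linear Cauchy-Davenport inequality \<open>dim A + dim B \<le> dim C + 1\<close> holds whenever
  \<open>AB \<subseteq> C \<noteq> L\<close>: Dyson's transform replaces \<open>(A, B)\<close> by \<open>(A + eB, B \<inter> e\<^sup>-\<^sup>1A)\<close> and shrinks \<open>B\<close>, unless \<open>A\<close>
  is stable under an element outside \<open>K\<close>, which forces \<open>A = L\<close>, or \<open>dim B = 1\<close>.

  Given a basis \<open>a\<^sub>i\<close> of \<open>A\<close>, put \<open>V\<^sub>i = {b \<in> B. a\<^sub>i b \<in> A}\<close>. If \<open>U\<close> is the intersection of the \<open>V\<^sub>i\<close> with
  \<open>i \<in> J\<close>, then the span of these \<open>a\<^sub>i\<close> multiplies \<open>U + K\<close> into \<open>A\<close>; as \<open>1 \<notin> B\<close>, the inequality gives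
  \<open>|J| + dim U \<le> n\<close>. This is the dual form of Rado's condition. It allows the \<open>V\<^sub>i\<close> to be enlarged to
  hyperplanes of \<open>B\<close> in general position, and the dual basis of these is matched to the \<open>a\<^sub>i\<close>.
\<close>


section \<open>Subspaces and their dimension\<close>

context embedded_algebra
begin

declare Span.simps [simp del]

lemma subfield_K: "subfield K R" by (rule K.subfield_axioms)

lemma dimension_dim:
  assumes "finite_dimension K E" shows "dimension (dim K E) K E"
  using finite_dimensionE[OF subfield_K assms] by (simp add: over_def)

lemma dim_eqI:
  assumes "dimension n K E" shows "dim K E = n"
  using dimI[OF subfield_K assms] by (simp add: over_def)

lemma dim_mono:
  assumes "finite_dimension K W" "subalgebra K V R" "V \<subseteq> W"
  shows "dim K V \<le> dim K W"
proof -
  have "finite_dimension K V"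
    using subalbegra_incl_imp_finite_dimension[OF subfield_K assms] .
  then obtain Us where "independent K Us" "length Us = dim K V" "Span K Us = V" "set Us \<subseteq> carrier R"
    using exists_base[OF subfield_K dimension_dim] by blast
  moreover from this have "set Us \<subseteq> W"
    using Span_base_incl[OF subfield_K] assms(3) by blast
  ultimately show ?thesis
    using independent_length_le_dimension[OF subfield_K dimension_dim[OF assms(1)]] by metis
qed

lemma subspace_eqI:
  assumes "finite_dimension K W" "subalgebra K V R" "V \<subseteq> W" "dim K W \<le> dim K V"
  shows "V = W"
proof -
  have "finite_dimension K V"
    using subalbegra_incl_imp_finite_dimension[OF subfield_K assms(1-3)] .
  then obtain Us where Us: "independent K Us" "length Us = dim K V" "Span K Us = V" "set Us \<subseteq> carrier R"
    using exists_base[OF subfield_K dimension_dim] by blast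
  moreover from this have "set Us \<subseteq> W"
    using Span_base_incl[OF subfield_K] assms(3) by blast
  moreover have "length Us = dim K W"
    using Us(2) dim_mono[OF assms(1-3)] assms(4) by simp
  ultimately show ?thesis
    using independent_length_eq_dimension[OF subfield_K dimension_dim[OF assms(1)], of Us] by simp
qed

lemma finite_dimension_Int:
  assumes "finite_dimension K V" "finite_dimension K W"
  shows "finite_dimension K (V \<inter> W)"
  using subalbegra_incl_imp_finite_dimension[OF subfield_K assms(1)] assms
    subalgebra_inter finite_dimension_imp_subalgebra[OF subfield_K] by blast

lemma dim_sum_Int:
  assumes "finite_dimension K V" "finite_dimension K W"
  shows "dim K (V <+>\<^bsub>R\<^esub> W) + dim K (V \<inter> W) = dim K V + dim K W"
proof -
  \<comment> \<open>The library's formula for sums subtracts in \<open>nat\<close>; this bound keeps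
    the subtraction from truncating.\<close>
  have "dim K (V \<inter> W) \<le> dim K V"
    using dim_mono[OF assms(1)] finite_dimension_Int[OF assms]
      finite_dimension_imp_subalgebra[OF subfield_K] by blast
  thus ?thesis
    using sum_space_dim(2)[OF subfield_K assms] by (simp add: over_def)
qed

section \<open>Closure properties of subspaces\<close>

lemma subspace_props:
  assumes "subalgebra K V R"
  shows "V \<subseteq> carrier R" "\<zero> \<in> V" "\<And>x y. \<lbrakk> x \<in> V; y \<in> V \<rbrakk> \<Longrightarrow> x \<oplus> y \<in> V"
    "\<And>x. x \<in> V \<Longrightarrow> \<ominus> x \<in> V" "\<And>k x. \<lbrakk> k \<in> K; x \<in> V \<rbrakk> \<Longrightarrow> k \<otimes> x \<in> V"
proof -
  interpret V: subalgebra K V R by (rule assms)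
  \<comment> \<open>A \<open>subalgebra\<close> is a subgroup of the additive monoid, so
    \<open>one_closed\<close> and \<open>m_closed\<close> speak of zero and addition here.\<close>
  show "V \<subseteq> carrier R" "\<zero> \<in> V" "\<And>x y. \<lbrakk> x \<in> V; y \<in> V \<rbrakk> \<Longrightarrow> x \<oplus> y \<in> V"
    using V.subset V.one_closed V.m_closed by auto
  show "\<And>x. x \<in> V \<Longrightarrow> \<ominus> x \<in> V" "\<And>k x. \<lbrakk> k \<in> K; x \<in> V \<rbrakk> \<Longrightarrow> k \<otimes> x \<in> V"
    using V.m_inv_closed V.smult_closed by (auto simp: a_inv_def)
qed

text \<open>Negatives come from multiplication by the scalar \<open>\<ominus> \<one>\<close>, which
  lies in \<open>K\<close>.\<close>

lemma subspaceI:
  assumes "V \<subseteq> carrier R" "\<zero> \<in> V" "\<And>x y. \<lbrakk> x \<in> V; y \<in> V \<rbrakk> \<Longrightarrow> x \<oplus> y \<in> V"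
    "\<And>k x. \<lbrakk> k \<in> K; x \<in> V \<rbrakk> \<Longrightarrow> k \<otimes> x \<in> V"
  shows "subalgebra K V R"
proof (intro subalgebra.intro subalgebra_axioms.intro add.subgroupI)
  fix x assume x: "x \<in> V"
  have "\<ominus> \<one> \<in> K"
    using subringE(3,5)[OF subfieldE(1)[OF subfield_K]] by blast
  hence "\<ominus> \<one> \<otimes> x \<in> V"
    using assms(4) x by blast
  moreover have "\<ominus> \<one> \<otimes> x = \<ominus> x"
    using x assms(1) l_minus[of \<one> x] by auto
  ultimately show "\<ominus> x \<in> V" by simp
qed (use assms in auto)

section \<open>Sums of two subspaces\<close>

lemma mem_set_add_iff: "x \<in> V <+>\<^bsub>R\<^esub> W \<longleftrightarrow> (\<exists>v \<in> V. \<exists>w \<in> W. x = v \<oplus> w)"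
  unfolding set_add_def' by blast

lemma set_add_memI: "\<lbrakk> v \<in> V; w \<in> W \<rbrakk> \<Longrightarrow> v \<oplus> w \<in> V <+>\<^bsub>R\<^esub> W"
  using mem_set_add_iff by blast

lemma set_add_incl:
  assumes "subalgebra K V R" "subalgebra K W R"
  shows "V \<subseteq> V <+>\<^bsub>R\<^esub> W" "W \<subseteq> V <+>\<^bsub>R\<^esub> W"
proof -
  note V = subspace_props[OF assms(1)] and W = subspace_props[OF assms(2)]
  show "V \<subseteq> V <+>\<^bsub>R\<^esub> W"
  proof
    fix v assume v: "v \<in> V"
    thus "v \<in> V <+>\<^bsub>R\<^esub> W" using set_add_memI[OF v W(2)] V(1) by (simp add: subset_iff)
  qed
  show "W \<subseteq> V <+>\<^bsub>R\<^esub> W"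
  proof
    fix w assume w: "w \<in> W"
    thus "w \<in> V <+>\<^bsub>R\<^esub> W" using set_add_memI[OF V(2) w] W(1) by (simp add: subset_iff)
  qed
qed

lemma set_add_least:
  assumes "subalgebra K E R" "V \<subseteq> E" "W \<subseteq> E"
  shows "V <+>\<^bsub>R\<^esub> W \<subseteq> E"
  using assms(2,3) by (auto simp: mem_set_add_iff intro!: subspace_props(3)[OF assms(1)])

lemma set_add_subspace:
  assumes "subalgebra K V R" "subalgebra K W R"
  shows "subalgebra K (V <+>\<^bsub>R\<^esub> W) R"
proof (rule subspaceI)
  note V = subspace_props[OF assms(1)] and W = subspace_props[OF assms(2)]
  show "V <+>\<^bsub>R\<^esub> W \<subseteq> carrier R"
    using set_add_closed V(1) W(1) by blast
  show "\<zero> \<in> V <+>\<^bsub>R\<^esub> W"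
    using set_add_incl[OF assms] V(2) by blast
  fix x y assume "x \<in> V <+>\<^bsub>R\<^esub> W" "y \<in> V <+>\<^bsub>R\<^esub> W"
  then obtain v w v' w' where
    vw: "v \<in> V" "w \<in> W" "x = v \<oplus> w" "v' \<in> V" "w' \<in> W" "y = v' \<oplus> w'"
    by (auto simp: mem_set_add_iff)
  moreover from vw have "x \<oplus> y = (v \<oplus> v') \<oplus> (w \<oplus> w')"
    using V(1) W(1) by (simp add: subset_iff a_ac)
  ultimately show "x \<oplus> y \<in> V <+>\<^bsub>R\<^esub> W"
    using set_add_memI[OF V(3) W(3)] by simp
next
  note V = subspace_props[OF assms(1)] and W = subspace_props[OF assms(2)]
  fix k x assume k: "k \<in> K" and "x \<in> V <+>\<^bsub>R\<^esub> W"
  then obtain v w where vw: "v \<in> V" "w \<in> W" "x = v \<oplus> w"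
    by (auto simp: mem_set_add_iff)
  moreover have "k \<otimes> x = k \<otimes> v \<oplus> k \<otimes> w"
    using vw k subfieldE(3)[OF subfield_K] V(1) W(1) r_distr by (auto simp: subset_iff)
  ultimately show "k \<otimes> x \<in> V <+>\<^bsub>R\<^esub> W"
    using set_add_memI[OF V(5) W(5)] k by simp
qed

section \<open>Linear independence of lists\<close>

text \<open>\<open>independent\<close> is built up from the tail: each new head must lie outside the
  span of what follows it. The hypothesis passes to the tail because adjoining the head only
  enlarges spans.\<close>

lemma independent_if_not_in_Span:
  assumes "set Us \<subseteq> carrier R"
    and "\<And>i. i < length Us \<Longrightarrow> Us ! i \<notin> Span K (take i Us @ drop (Suc i) Us)"
  shows "independent K Us"
  using assms
proof (induction Us)
  case (Cons u Us)
  have "Us ! i \<notin> Span K (take i Us @ drop (Suc i) Us)" if "i < length Us" for i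
  proof -
    have "set (take i Us @ drop (Suc i) Us) \<subseteq> carrier R"
      using Cons.prems(1) set_take_subset[of i Us] set_drop_subset[of "Suc i" Us] by auto
    moreover have "u \<in> carrier R" using Cons.prems(1) by simp
    ultimately have "Span K (take i Us @ drop (Suc i) Us) \<subseteq> Span K (u # take i Us @ drop (Suc i) Us)"
      by (rule mono_Span[OF subfield_K])
    moreover have "Us ! i \<notin> Span K (u # take i Us @ drop (Suc i) Us)"
      using Cons.prems(2)[of "Suc i"] that by simp
    ultimately show ?thesis by blast
  qed
  hence "independent K Us" using Cons by simp
  moreover have "u \<notin> Span K Us" using Cons.prems(2)[of 0] by simp
  ultimately show ?case using Cons.prems(1) by (simp add: li_Cons)
qed simp

text \<open>Independence does not depend on the order of the entries: move entry \<open>i\<close> to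
  the front, then drop it.\<close>

lemma independent_remove:
  assumes "independent K Us" "i < length Us"
  shows "independent K (take i Us @ drop (Suc i) Us)"
proof -
  have eq: "take i Us @ Us ! i # drop (Suc i) Us = Us"
    using assms(2) by (simp add: id_take_nth_drop[symmetric])
  have "set Us = set (Us ! i # (take i Us @ drop (Suc i) Us))"
    by (subst eq[symmetric]) auto
  moreover have "length Us = length (Us ! i # (take i Us @ drop (Suc i) Us))"
    using assms(2) by simp
  ultimately have "independent K (Us ! i # (take i Us @ drop (Suc i) Us))"
    using independent_same_set[OF subfield_K] assms(1) by blast
  thus ?thesis by (rule independent_backwards)
qed

text \<open>A head outside the span of the tail is outside the span of every sublist of the tail.
  This turns an index set \<open>J\<close> into an independent list, through which
  \<open>card J\<close> bounds a dimension from below.\<close>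

lemma independent_nths:
  assumes "independent K Us"
  shows "independent K (nths Us J)"
  using assms
proof (induction Us arbitrary: J rule: list.induct)
  case (Cons u Us)
  note u = independent_backwards[OF Cons.prems]
  have "set (nths Us {j. Suc j \<in> J}) \<subseteq> set Us" by (rule set_nths_subset)
  hence "Span K (nths Us {j. Suc j \<in> J}) \<subseteq> Span K Us"
    using independent_in_carrier[OF u(2)] by (rule mono_Span_sublist[OF subfield_K])
  hence "u \<notin> Span K (nths Us {j. Suc j \<in> J})" using u(1) by blast
  hence "independent K (u # nths Us {j. Suc j \<in> J})"
    using Cons.IH[OF u(2)] by (rule li_Cons[OF u(3)])
  thus ?case
    using Cons.IH[OF u(2)] by (simp add: nths_Cons)
qed simp


section \<open>Bases avoiding a family of subspaces\<close>

text \<open>Any \<open>k\<close> members meet in codimension at least \<open>k\<close> when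
  \<open>B\<close> has dimension \<open>n\<close>. For the annihilators in the dual of
  \<open>B\<close> this is Rado's condition for an independent transversal. With
  \<open>J = {}\<close> the intersection is \<open>B\<close> itself.\<close>

definition rado_family :: "nat \<Rightarrow> 'a set \<Rightarrow> (nat \<Rightarrow> 'a set) \<Rightarrow> bool"
  where "rado_family n B V \<longleftrightarrow>
    (\<forall>i < n. subalgebra K (V i) R \<and> V i \<subseteq> B) \<and>
    (\<forall>J \<subseteq> {..<n}. dim K {x \<in> B. \<forall>i \<in> J. x \<in> V i} + card J \<le> n)"

lemma subspace_Inter:
  assumes "subalgebra K B R" "\<And>i. i \<in> J \<Longrightarrow> subalgebra K (V i) R"
  shows "subalgebra K {x \<in> B. \<forall>i \<in> J. x \<in> V i} R"
proof (rule subspaceI)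
  note B = subspace_props[OF assms(1)] and V = subspace_props[OF assms(2)]
  show "{x \<in> B. \<forall>i \<in> J. x \<in> V i} \<subseteq> carrier R" using B(1) by blast
  show "\<zero> \<in> {x \<in> B. \<forall>i \<in> J. x \<in> V i}" using B(2) V(2) by blast
  show "x \<oplus> y \<in> {x \<in> B. \<forall>i \<in> J. x \<in> V i}"
    if "x \<in> {x \<in> B. \<forall>i \<in> J. x \<in> V i}" "y \<in> {x \<in> B. \<forall>i \<in> J. x \<in> V i}" for x y
    using that B(3) V(3) by blast
  show "k \<otimes> x \<in> {x \<in> B. \<forall>i \<in> J. x \<in> V i}"
    if "k \<in> K" "x \<in> {x \<in> B. \<forall>i \<in> J. x \<in> V i}" for k x
    using that B(5) V(5) by blast
qed

section \<open>Adjoining one vector to a subspace\<close>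

lemma line_extension_subspace:
  assumes "subalgebra K V R" "x \<in> carrier R"
  shows "subalgebra K (line_extension K x V) R" "V \<subseteq> line_extension K x V"
    "x \<in> line_extension K x V"
proof -
  note V = subspace_props[OF assms(1)]
  have VK: "\<zero> \<in> K" "\<one> \<in> K" "K \<subseteq> carrier R"
    using subringE[OF subfieldE(1)[OF subfield_K]] by blast+
  have sub: "subgroup (line_extension K x V) (add_monoid R)"
    using line_extension_is_subgroup[OF subfield_K] assms by (simp add: subalgebra_def)
  show "subalgebra K (line_extension K x V) R"
    using sub line_extension_smult_closed[OF subfield_K V(5) V(1) assms(2)]
    by (simp add: subalgebra_def subalgebra_axioms_def)
  show "V \<subseteq> line_extension K x V"
  proof
    fix v assume "v \<in> V"
    moreover from this have "v = \<zero> \<otimes> x \<oplus> v" using V(1) assms(2) by auto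
    ultimately show "v \<in> line_extension K x V" using VK(1) line_extension_mem_iff by blast
  qed
  have "x = \<one> \<otimes> x \<oplus> \<zero>" using assms(2) by auto
  thus "x \<in> line_extension K x V" using VK(2) V(2) line_extension_mem_iff by blast
qed

lemma line_extension_least:
  assumes "subalgebra K E R" "x \<in> E" "V \<subseteq> E"
  shows "line_extension K x V \<subseteq> E"
proof
  fix y assume "y \<in> line_extension K x V"
  then obtain k v where kv: "k \<in> K" "v \<in> V" and y: "y = k \<otimes> x \<oplus> v"
    by (auto simp: line_extension_mem_iff)
  have "k \<otimes> x \<in> E" using subspace_props(5)[OF assms(1) kv(1) assms(2)] .
  thus "y \<in> E"
    unfolding y by (rule subspace_props(3)[OF assms(1)]) (use kv assms(3) in blast)
qed

lemma dim_line_extension: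
  assumes "finite_dimension K V" "x \<in> carrier R" "x \<notin> V"
  shows "dim K (line_extension K x V) = Suc (dim K V)"
  using Suc_dim[OF assms(2,3) dimension_dim[OF assms(1)]] by (rule dim_eqI)

text \<open>Rado's condition survives the enlargement of some \<open>V i\<close> of codimension at least 2: take
  \<open>W\<close> and \<open>Y\<close> one dimension larger than \<open>V i = W \<inter> Y\<close>. If the condition failed for both, at index
  sets \<open>J1\<close> and \<open>J2\<close>, modularity of the dimension would contradict it for \<open>V\<close> at
  \<open>insert i (J1 \<union> J2)\<close> or \<open>J1 \<inter> J2\<close>.\<close>

lemma rado_family_extend:
  assumes B: "dimension n K B" and V: "rado_family n B V"
    and i: "i < n" and codim: "Suc (dim K (V i)) < n"
  obtains W where "V i \<subseteq> W" "dim K W = Suc (dim K (V i))" "rado_family n B (V(i := W))"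
proof -
  have fB: "finite_dimension K B" using B by (rule finite_dimensionI)
  have sB: "subalgebra K B R" using finite_dimension_imp_subalgebra[OF subfield_K fB] .
  have dB: "dim K B = n" using B by (rule dim_eqI)
  note B_props = subspace_props[OF sB]
  have sV: "subalgebra K (V j) R" "V j \<subseteq> B" if "j < n" for j
    using V that by (auto simp: rado_family_def)
  have fin: "finite_dimension K U" if "subalgebra K U R" "U \<subseteq> B" for U
    using subalbegra_incl_imp_finite_dimension[OF subfield_K fB that] .
  define I where "I J = {x \<in> B. \<forall>j \<in> J. x \<in> V j}" for J
  have sI: "subalgebra K (I J) R" "I J \<subseteq> B" if "J \<subseteq> {..<n}" for J
    using subspace_Inter[OF sB, of J V] sV that by (auto simp: I_def)
  have dI: "dim K (I J) + card J \<le> n" if "J \<subseteq> {..<n}" for J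
    using V that by (simp add: rado_family_def I_def)
  have "V i \<noteq> B" using codim dB by auto
  then obtain x where x: "x \<in> B" "x \<notin> V i"
    using sV(2)[OF i] by blast
  define W where "W = line_extension K x (V i)"
  have xR: "x \<in> carrier R" using x B_props by blast
  have W: "subalgebra K W R" "V i \<subseteq> W" "W \<subseteq> B" "dim K W = Suc (dim K (V i))"
    using line_extension_subspace[OF sV(1)[OF i] xR] line_extension_least[OF sB x(1) sV(2)[OF i]]
      dim_line_extension[OF fin[OF sV[OF i]] xR x(2)] by (auto simp: W_def)
  have "W \<noteq> B" using W(4) codim dB by auto
  then obtain y where y: "y \<in> B" "y \<notin> W"
    using W(3) by blast
  define Y where "Y = line_extension K y (V i)"
  have yR: "y \<in> carrier R" using y B_props by blast
  have yV: "y \<notin> V i" using y W by blast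
  have Y: "subalgebra K Y R" "V i \<subseteq> Y" "Y \<subseteq> B" "dim K Y = Suc (dim K (V i))" "y \<in> Y"
    using line_extension_subspace[OF sV(1)[OF i] yR] line_extension_least[OF sB y(1) sV(2)[OF i]]
      dim_line_extension[OF fin[OF sV[OF i]] yR yV] by (auto simp: Y_def)
  have sWY: "subalgebra K (W \<inter> Y) R" using subalgebra_inter W(1) Y(1) by blast
  have WY: "W \<inter> Y = V i"
  proof -
    have "W \<inter> Y \<noteq> Y" using Y(5) y(2) by blast
    hence "\<not> dim K Y \<le> dim K (W \<inter> Y)"
      using subspace_eqI[OF fin[OF Y(1,3)] sWY] by blast
    hence "dim K (W \<inter> Y) \<le> dim K (V i)" using Y(4) by simp
    thus ?thesis
      using subspace_eqI[OF fin[OF sWY] sV(1)[OF i]] W Y by blast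
  qed
  \<comment> \<open>A violating index set must contain \<open>i\<close>, since otherwise
    \<open>V\<close> itself would violate the condition. It is recorded without \<open>i\<close>,
    which turns \<open>> n\<close> into \<open>\<ge> n\<close>.\<close>
  have bad: "\<exists>J \<subseteq> {..<n} - {i}. n \<le> dim K (Z \<inter> I J) + card J"
    if Z: "subalgebra K Z R" "Z \<subseteq> B" "\<not> rado_family n B (V(i := Z))" for Z
  proof -
    obtain J where J: "J \<subseteq> {..<n}"
      "\<not> dim K {x \<in> B. \<forall>j \<in> J. x \<in> (V(i := Z)) j} + card J \<le> n"
      using Z sV unfolding rado_family_def by (auto split: if_splits)
    have iJ: "i \<in> J"
    proof (rule ccontr)
      assume "i \<notin> J"
      hence "{x \<in> B. \<forall>j \<in> J. x \<in> (V(i := Z)) j} = I J" by (auto simp: I_def)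
      thus False using J dI by simp
    qed
    have "{x \<in> B. \<forall>j \<in> J. x \<in> (V(i := Z)) j} = Z \<inter> I (J - {i})"
      using iJ Z(2) by (auto simp: I_def)
    moreover have "card J = Suc (card (J - {i}))"
      using iJ J(1) by (metis card_Suc_Diff1 finite_lessThan finite_subset)
    ultimately have "n \<le> dim K (Z \<inter> I (J - {i})) + card (J - {i})" using J(2) by simp
    thus ?thesis using J(1) by blast
  qed
  have "rado_family n B (V(i := W)) \<or> rado_family n B (V(i := Y))"
  proof (rule ccontr)
    assume "\<not> ?thesis"
    hence not_rado: "\<not> rado_family n B (V(i := W))" "\<not> rado_family n B (V(i := Y))"
      by simp_all
    obtain J1 where J1: "J1 \<subseteq> {..<n} - {i}" "n \<le> dim K (W \<inter> I J1) + card J1"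
      using bad[OF W(1,3) not_rado(1)] by blast
    obtain J2 where J2: "J2 \<subseteq> {..<n} - {i}" "n \<le> dim K (Y \<inter> I J2) + card J2"
      using bad[OF Y(1,3) not_rado(2)] by blast
    have sub: "J1 \<subseteq> {..<n}" "J2 \<subseteq> {..<n}" "J1 \<inter> J2 \<subseteq> {..<n}" "insert i (J1 \<union> J2) \<subseteq> {..<n}"
      using J1 J2 i by auto
    have fJ: "finite J1" "finite J2" using sub finite_subset by blast+
    let ?P = "W \<inter> I J1" and ?Q = "Y \<inter> I J2"
    have sP: "subalgebra K ?P R" "subalgebra K ?Q R"
      by (rule subalgebra_inter[OF W(1) sI(1)[OF sub(1)]],
          rule subalgebra_inter[OF Y(1) sI(1)[OF sub(2)]])
    have fP: "finite_dimension K ?P" "finite_dimension K ?Q"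
      by (rule fin[OF sP(1)], use W(3) in blast, rule fin[OF sP(2)], use Y(3) in blast)
    \<comment> \<open>The index \<open>i\<close> is gained from \<open>W \<inter> Y = V i\<close>;
      it is the source of the \<open>Suc\<close> in the next bound.\<close>
    have "?P \<inter> ?Q = I (insert i (J1 \<union> J2))"
      using WY sV(2)[OF i] by (auto simp: I_def)
    hence 1: "dim K (?P \<inter> ?Q) + Suc (card (J1 \<union> J2)) \<le> n"
      using dI[OF sub(4)] J1(1) J2(1) fJ by (subst (asm) card_insert_disjoint) auto
    have "?P <+>\<^bsub>R\<^esub> ?Q \<subseteq> I (J1 \<inter> J2)"
      by (intro set_add_least sI sub) (auto simp: I_def)
    hence "dim K (?P <+>\<^bsub>R\<^esub> ?Q) \<le> dim K (I (J1 \<inter> J2))"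
      using dim_mono[OF fin[OF sI[OF sub(3)]] set_add_subspace[OF sP]] by blast
    hence 2: "dim K (?P <+>\<^bsub>R\<^esub> ?Q) + card (J1 \<inter> J2) \<le> n"
      using dI[OF sub(3)] by simp
    \<comment> \<open>By modularity of \<open>dim\<close> and \<open>card\<close>, \<open>1\<close>
      and \<open>2\<close> add up to
      \<open>dim ?P + card J1 + dim ?Q + card J2 + 1 \<le> 2n\<close>, while the choice of
      \<open>J1\<close> and \<open>J2\<close> makes the first four terms at least
      \<open>2n\<close>.\<close>
    show False
      using 1 2 J1(2) J2(2) dim_sum_Int[OF fP] card_Un_Int[OF fJ] by linarith
  qed
  thus ?thesis
  proof
    assume "rado_family n B (V(i := W))"
    thus ?thesis by (rule that[OF W(2,4)])
  next
    assume "rado_family n B (V(i := Y))"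
    thus ?thesis by (rule that[OF Y(2,4)])
  qed
qed

text \<open>Induction on the total codimension, which each use of \<open>rado_family_extend\<close>
  lowers. Rado's condition at a singleton gives the opposite bound, so each \<open>H i\<close> has
  codimension exactly 1.\<close>

lemma rado_family_hyperplanes:
  assumes "dimension n K B" "rado_family n B V"
  shows "\<exists>H. rado_family n B H \<and> (\<forall>i<n. V i \<subseteq> H i) \<and> (\<forall>i<n. n \<le> Suc (dim K (H i)))"
  using assms(2)
proof (induction "\<Sum>i<n. n - dim K (V i)" arbitrary: V rule: less_induct)
  case less
  show ?case
  proof (cases "\<forall>i<n. n \<le> Suc (dim K (V i))")
    case True
    with less.prems show ?thesis by (intro exI[of _ V]) simp
  next
    case False
    then obtain i where i: "i < n" "Suc (dim K (V i)) < n" by (auto simp: not_le)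
    obtain W where W: "V i \<subseteq> W" "dim K W = Suc (dim K (V i))" "rado_family n B (V(i := W))"
      using rado_family_extend[OF assms(1) less.prems i] .
    have "(\<Sum>j<n. n - dim K ((V(i := W)) j)) < (\<Sum>j<n. n - dim K (V j))"
    proof (rule sum_strict_mono_ex1)
      show "\<forall>j\<in>{..<n}. n - dim K ((V(i := W)) j) \<le> n - dim K (V j)" using W by auto
      show "\<exists>j\<in>{..<n}. n - dim K ((V(i := W)) j) < n - dim K (V j)"
        using W i by (intro bexI[of _ i]) auto
    qed simp
    from less.hyps[OF this W(3)] obtain H where H: "rado_family n B H"
      "\<forall>j<n. (V(i := W)) j \<subseteq> H j" "\<forall>j<n. n \<le> Suc (dim K (H j))"
      by (elim exE conjE)
    have "V j \<subseteq> H j" if "j < n" for j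
      using H(2)[rule_format, OF that] W(1) by (cases "j = i") auto
    with H show ?thesis by (intro exI[of _ H]) simp
  qed
qed

text \<open>The hyperplanes \<open>H i\<close> are in general position. Their dual basis takes as
  \<open>i\<close>-th vector one lying in every \<open>H j\<close> with \<open>j \<noteq> i\<close>
  but not in \<open>H i\<close>; the remaining vectors then span \<open>H i\<close>.\<close>

lemma exists_basis_avoiding:
  assumes B: "dimension n K B" and V: "rado_family n B V"
  obtains Bs where "basis_of K B Bs" "length Bs = n"
    "\<And>i. i < n \<Longrightarrow> V i \<subseteq> Span K (take i Bs @ drop (Suc i) Bs)"
proof -
  have fB: "finite_dimension K B" using B by (rule finite_dimensionI)
  have sB: "subalgebra K B R" using finite_dimension_imp_subalgebra[OF subfield_K fB] .
  have dB: "dim K B = n" using B by (rule dim_eqI)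
  have fin: "finite_dimension K U" if "subalgebra K U R" "U \<subseteq> B" for U
    using subalbegra_incl_imp_finite_dimension[OF subfield_K fB that] .
  obtain H where H: "rado_family n B H" "\<forall>i<n. V i \<subseteq> H i" "\<forall>i<n. n \<le> Suc (dim K (H i))"
    using rado_family_hyperplanes[OF assms] by (elim exE conjE)
  have sH: "subalgebra K (H i) R" "H i \<subseteq> B" if "i < n" for i
    using H(1) that by (auto simp: rado_family_def)
  define I where "I J = {x \<in> B. \<forall>j \<in> J. x \<in> H j}" for J
  have sI: "subalgebra K (I J) R" "I J \<subseteq> B" if "J \<subseteq> {..<n}" for J
    using subspace_Inter[OF sB, of J H] sH that by (auto simp: I_def)
  have dI: "dim K (I J) + card J \<le> n" if "J \<subseteq> {..<n}" for J
    using H(1) that by (simp add: rado_family_def I_def)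
  \<comment> \<open>Each further hyperplane cuts the dimension by at most 1. Together with
    \<open>dI\<close>, any \<open>J\<close> gives an intersection of dimension exactly
    \<open>n - card J\<close>.\<close>
  have low: "n \<le> dim K (I J) + card J" if "finite J" "J \<subseteq> {..<n}" for J
    using that
  proof (induction J rule: finite_induct)
    case empty thus ?case using dB by (simp add: I_def)
  next
    case (insert j J)
    have j: "j < n" "J \<subseteq> {..<n}" using insert.prems by auto
    have s: "subalgebra K (I J) R" "I J \<subseteq> B" using sI j by auto
    have f: "finite_dimension K (I J)" "finite_dimension K (H j)"
      using fin[OF s] fin[OF sH[OF j(1)]] by simp_all
    have "I (insert j J) = I J \<inter> H j" by (auto simp: I_def)
    moreover have "dim K (I J <+>\<^bsub>R\<^esub> H j) \<le> n"
      using dim_mono[OF fB set_add_subspace[OF s(1) sH(1)[OF j(1)]]]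
        set_add_least[OF sB s(2) sH(2)[OF j(1)]] dB by simp
    moreover have "n \<le> dim K (I J) + card J" using insert.IH j by simp
    ultimately show ?case
      using dim_sum_Int[OF f] H(3)[rule_format, OF j(1)] insert.hyps by simp
  qed
  have "dim K (I {..<n}) = 0" using dI[of "{..<n}"] by simp
  moreover have "finite_dimension K (I {..<n})" using fin[OF sI[OF subset_refl]] .
  ultimately have I0: "I {..<n} = {\<zero>}" using dimension_dim dimension_zero[OF subfield_K] by metis
  \<comment> \<open>All but one of the hyperplanes meet in a nonzero space, whereas all of them meet
    in zero.\<close>
  have "\<exists>b. b \<in> I ({..<n} - {i}) \<and> b \<notin> H i" if i: "i < n" for i
  proof -
    have "dim K (I ({..<n} - {i})) \<noteq> 0" using low[of "{..<n} - {i}"] i by auto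
    hence "I ({..<n} - {i}) \<noteq> {\<zero>}" using dim_eqI[OF zero_dim] by metis
    moreover have "\<zero> \<in> I ({..<n} - {i})" 
      by (rule subspace_props(2)[OF sI(1)]) blast
    ultimately obtain b where b: "b \<in> I ({..<n} - {i})" "b \<noteq> \<zero>" by blast
    have "b \<notin> H i"
    proof
      assume "b \<in> H i"
      hence "b \<in> I {..<n}" using b(1) by (auto simp: I_def)
      thus False using I0 b(2) by simp
    qed
    with b(1) show ?thesis by blast
  qed
  then obtain b where b: "\<And>i. i < n \<Longrightarrow> b i \<in> I ({..<n} - {i}) \<and> b i \<notin> H i" by metis
  define Bs where "Bs = map b [0..<n]"
  have len: "length Bs = n" by (simp add: Bs_def)
  have BsB: "set Bs \<subseteq> B" using b by (auto simp: Bs_def I_def)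
  hence BsR: "set Bs \<subseteq> carrier R" using subspace_props(1)[OF sB] by blast
  have inH: "Span K (take i Bs @ drop (Suc i) Bs) \<subseteq> H i" if i: "i < n" for i
  proof (rule subalgebra_Span_incl[OF subfield_K sH(1)[OF i]])
    have "b j \<in> H i" if "j < n" "j \<noteq> i" for j
      using b[OF that(1)] that i by (auto simp: I_def)
    thus "set (take i Bs @ drop (Suc i) Bs) \<subseteq> H i"
      using i by (auto simp: Bs_def take_map drop_map)
  qed
  have ind: "independent K Bs"
  proof (rule independent_if_not_in_Span[OF BsR])
    fix i assume "i < length Bs"
    hence i: "i < n" using len by simp
    show "Bs ! i \<notin> Span K (take i Bs @ drop (Suc i) Bs)"
      using inH[OF i] b[OF i] i by (auto simp: Bs_def)
  qed
  have "Span K Bs = B"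
    using independent_length_eq_dimension[OF subfield_K B ind BsB] len by simp
  hence "basis_of K B Bs" using ind by (simp add: basis_of_def)
  moreover have "V i \<subseteq> Span K (take i Bs @ drop (Suc i) Bs)" if i: "i < n" for i
  proof -
    let ?Us = "take i Bs @ drop (Suc i) Bs"
    have indU: "independent K ?Us" using independent_remove[OF ind] i len by simp
    hence "dim K (Span K ?Us) = length ?Us" using dim_eqI dimension_independent by blast
    moreover have "length ?Us = n - 1" using i len by simp
    moreover have "dim K (H i) \<le> n - 1"
    proof -
      have "I {i} = H i" using sH(2)[OF i] by (auto simp: I_def)
      thus ?thesis using dI[of "{i}"] i by simp
    qed
    ultimately have "Span K ?Us = H i"
      using subspace_eqI[OF fin[OF sH[OF i]] _ inH[OF i]]
        Span_is_subalgebra[OF subfield_K independent_in_carrier[OF indU]] by simp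
    thus ?thesis using H(2) i by simp
  qed
  ultimately show ?thesis using that len by blast
qed


section \<open>The linear Cauchy-Davenport inequality\<close>

text \<open>Multiplication by \<open>x\<close> commutes with linear combinations and has zero kernel
  in a field, so it carries a basis to a basis.\<close>

lemma dimension_mult_right:
  assumes "field R" and V: "dimension n K V" and x: "x \<in> carrier R" "x \<noteq> \<zero>"
  shows "dimension n K ((\<lambda>v. v \<otimes> x) ` V)"
proof -
  interpret F: field R by (rule assms(1))
  obtain Us where Us: "set Us \<subseteq> carrier R" "independent K Us" "length Us = n" "Span K Us = V"
    using exists_base[OF subfield_K V] by blast
  let ?Vs = "map (\<lambda>u. u \<otimes> x) Us"
  have Vs: "set ?Vs \<subseteq> carrier R" using Us(1) x(1) by auto
  have KR: "K \<subseteq> carrier R" by (rule subfieldE(3)[OF subfield_K])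
  have comb: "combine Ks ?Vs = combine Ks Us \<otimes> x" if "set Ks \<subseteq> K" for Ks
    using combine_l_distr[of Ks Us x] that KR Us(1) x(1) by auto
  have "independent K ?Vs"
  proof (rule trivial_combine_imp_independent[OF subfield_K Vs])
    fix Ks assume Ks: "set Ks \<subseteq> K" "combine Ks ?Vs = \<zero>"
    have "combine Ks Us \<in> carrier R" using combine_in_carrier Ks(1) KR Us(1) by auto
    hence "combine Ks Us = \<zero>" using Ks comb x F.integral by metis
    thus "set (take (length ?Vs) Ks) \<subseteq> {\<zero>}"
      using independent_imp_trivial_combine[OF subfield_K Us(2) Ks(1)] by simp
  qed
  moreover have "Span K ?Vs = (\<lambda>v. v \<otimes> x) ` V"
  proof -
    have "Span K ?Vs = {combine Ks Us \<otimes> x | Ks. set Ks \<subseteq> K}"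
      unfolding Span_eq_combine_set[OF subfield_K Vs] using comb by (metis (no_types, lifting))
    thus ?thesis
      unfolding Us(4)[symmetric] Span_eq_combine_set[OF subfield_K Us(1)] by auto
  qed
  ultimately show ?thesis using dimensionI[OF subfield_K, of ?Vs] Us(3) by simp
qed

text \<open>Strong induction on \<open>dim K B\<close> with \<open>C\<close> fixed. \<open>A\<close>
  must be arbitrary, since Dyson's transform enlarges it while it shrinks \<open>B\<close>.\<close>

lemma linear_cauchy_davenport:
  assumes "field R" and fin: "finite_dimension K (carrier R)"
    and primitive: "\<And>x. \<lbrakk> x \<in> carrier R; x \<notin> K \<rbrakk> \<Longrightarrow> simple_extension K x = carrier R"
    and "subalgebra K A R" "A \<noteq> {\<zero>}" and "subalgebra K B R" "B \<noteq> {\<zero>}"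
    and C: "subalgebra K C R" "C \<noteq> carrier R" and "\<And>a b. \<lbrakk> a \<in> A; b \<in> B \<rbrakk> \<Longrightarrow> a \<otimes> b \<in> C"
  shows "dim K A + dim K B \<le> Suc (dim K C)"
  using assms(4-7,10)
proof (induction "dim K B" arbitrary: A B rule: less_induct)
  case less
  interpret F: field R by (rule assms(1))
  have inverse: "inv x \<in> carrier R" "inv x \<otimes> x = \<one>" "inv x \<noteq> \<zero>"
    if "x \<in> carrier R" "x \<noteq> \<zero>" for x
  proof -
    have "x \<in> Units R" using that F.field_Units by simp
    thus 1: "inv x \<in> carrier R" "inv x \<otimes> x = \<one>" by simp_all
    show "inv x \<noteq> \<zero>" using 1 that(1) F.one_not_zero by (metis l_null)
  qed
  have fd: "finite_dimension K V" if "subalgebra K V R" for V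
    using subalbegra_incl_imp_finite_dimension[OF subfield_K fin that] subspace_props(1)[OF that] by blast
  have scale: "dimension (dim K V) K ((\<lambda>v. v \<otimes> x) ` V)"
    if "subalgebra K V R" "x \<in> carrier R" "x \<noteq> \<zero>" for V x
    using dimension_mult_right[OF assms(1) dimension_dim[OF fd]] that by blast
  have dim_scale: "dim K ((\<lambda>v. v \<otimes> x) ` V) = dim K V"
    if "subalgebra K V R" "x \<in> carrier R" "x \<noteq> \<zero>" for V x
    using scale[OF that] by (rule dim_eqI)
  have sub_scale: "subalgebra K ((\<lambda>v. v \<otimes> x) ` V) R"
    if "subalgebra K V R" "x \<in> carrier R" "x \<noteq> \<zero>" for V x
    using finite_dimension_imp_subalgebra[OF subfield_K finite_dimensionI[OF scale[OF that]]] .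
  note A = subspace_props[OF less.prems(1)]
  note B = subspace_props[OF less.prems(3)]
  note C_props = subspace_props[OF C(1)]
  note AB = less.prems(5)
  obtain b0 where b0: "b0 \<in> B" "b0 \<noteq> \<zero>" using B(2) less.prems(4) by blast
  have b0R: "b0 \<in> carrier R" "inv b0 \<in> carrier R" "inv b0 \<otimes> b0 = \<one>" "inv b0 \<noteq> \<zero>"
    using b0 B(1) inverse by blast+
  show ?case
  proof (cases "\<exists>a \<in> A. \<exists>b \<in> B. b \<otimes> (inv b0 \<otimes> a) \<notin> A")
    case True
    then obtain a b where ab: "a \<in> A" "b \<in> B" "b \<otimes> (inv b0 \<otimes> a) \<notin> A" by blast
    \<comment> \<open>Dyson's transform with multiplier \<open>e\<close> preserves the sum of the two dimensions.\<close>
    define e where "e = inv b0 \<otimes> a"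
    have aR: "a \<in> carrier R" and bR: "b \<in> carrier R" using ab A(1) B(1) by auto
    have "a \<noteq> \<zero>"
    proof
      assume "a = \<zero>"
      hence "b \<otimes> (inv b0 \<otimes> a) = \<zero>" using b0R bR by simp
      thus False using ab(3) A(2) by simp
    qed
    hence e: "e \<in> carrier R" "e \<noteq> \<zero>" using aR b0R F.integral by (auto simp: e_def)
    define B' where "B' = {v \<in> B. v \<otimes> e \<in> A}"
    let ?eB = "(\<lambda>v. v \<otimes> e) ` B"
    let ?A' = "A <+>\<^bsub>R\<^esub> ?eB"
    have sB': "subalgebra K B' R"
    proof (rule subspaceI)
      show "B' \<subseteq> carrier R" using B(1) by (auto simp: B'_def)
      show "\<zero> \<in> B'" using B(2) A(2) e by (simp add: B'_def)
      show "v \<oplus> w \<in> B'" if "v \<in> B'" "w \<in> B'" for v w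
        using that B(1,3) A(3) e by (auto simp: B'_def l_distr subset_iff)
      show "k \<otimes> v \<in> B'" if "k \<in> K" "v \<in> B'" for k v
        using that B(1,5) A(5) e subfieldE(3)[OF subfield_K] by (auto simp: B'_def m_assoc subset_iff)
    qed
    have seB: "subalgebra K ?eB R" using sub_scale less.prems(3) e by blast
    have sA': "subalgebra K ?A' R" using set_add_subspace[OF less.prems(1) seB] .
    have "A \<inter> ?eB = (\<lambda>v. v \<otimes> e) ` B'" by (auto simp: B'_def)
    hence dims: "dim K ?A' + dim K B' = dim K A + dim K B"
      using dim_sum_Int[OF fd[OF less.prems(1)] fd[OF seB]] dim_scale[OF sB' e]
        dim_scale[OF less.prems(3) e] by simp
    have "B' \<subseteq> B" "b \<notin> B'" using ab(3) by (auto simp: B'_def e_def)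
    hence "\<not> dim K B \<le> dim K B'"
      using subspace_eqI[OF fd[OF less.prems(3)] sB'] ab(2) by blast
    hence small: "dim K B' < dim K B" by simp
    \<comment> \<open>The factor \<open>inv b0\<close> in \<open>e\<close> is there for this:
      \<open>b0\<close> stays in \<open>B'\<close>, so \<open>B'\<close> is nonzero, while
      \<open>b\<close> drops out and makes \<open>B'\<close> smaller.\<close>
    have "b0 \<otimes> e = a"
      using b0R aR by (simp add: e_def m_assoc[symmetric] F.m_comm[of b0])
    hence "b0 \<in> B'" using b0(1) ab(1) by (simp add: B'_def)
    hence B'0: "B' \<noteq> {\<zero>}" using b0(2) by blast
    have "A \<subseteq> ?A'" using set_add_incl(1)[OF less.prems(1) seB] .
    hence A'0: "?A' \<noteq> {\<zero>}" using less.prems(2) A(2) by blast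
    have prod: "s \<otimes> v \<in> C" if s: "s \<in> ?A'" and v: "v \<in> B'" for s v
    proof -
      obtain a' w where aw: "a' \<in> A" "w \<in> B" "s = a' \<oplus> w \<otimes> e"
        using s unfolding mem_set_add_iff by blast
      have R: "a' \<in> carrier R" "w \<in> carrier R" "v \<in> carrier R"
        using aw A(1) B(1) v by (auto simp: B'_def)
      \<comment> \<open>By commutativity \<open>e\<close> is moved from \<open>w\<close> to
        \<open>v\<close>; as \<open>v \<otimes> e\<close> lies in \<open>A\<close>, both summands
        are products from \<open>A\<close> and \<open>B\<close>.\<close>
      have "s \<otimes> v = a' \<otimes> v \<oplus> (v \<otimes> e) \<otimes> w"
        unfolding aw(3) using R e by algebra
      moreover have "a' \<otimes> v \<in> C" "(v \<otimes> e) \<otimes> w \<in> C"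
        using AB aw v by (auto simp: B'_def)
      ultimately show ?thesis using C_props(3) by simp
    qed
    have "dim K ?A' + dim K B' \<le> Suc (dim K C)"
      by (rule less.hyps[OF small sA' A'0 sB' B'0 prod])
    thus ?thesis using dims by simp
  next
    case False
    \<comment> \<open>Multiplication by \<open>b0\<close> embeds \<open>A\<close> into
      \<open>C\<close>, so it remains to show \<open>dim K B \<le> 1\<close>.\<close>
    have "(\<lambda>v. v \<otimes> b0) ` A \<subseteq> C" using AB b0(1) by auto
    hence AC: "dim K A \<le> dim K C"
      using dim_mono[OF fd[OF C(1)] sub_scale] dim_scale less.prems(1) b0R(1) b0(2) by metis
    \<comment> \<open>In this case \<open>inv b0 \<otimes> b\<close> maps \<open>A\<close> into
      itself, and so does every element of the extension it generates. If it were outside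
      \<open>K\<close>, the whole field would stabilize \<open>A\<close>.\<close>
    have "inv b0 \<otimes> b \<in> K" if b: "b \<in> B" for b
    proof (rule ccontr)
      let ?x = "inv b0 \<otimes> b"
      assume "?x \<notin> K"
      moreover have bR: "b \<in> carrier R" using b B(1) by blast
      ultimately have gen: "simple_extension K ?x = carrier R" using primitive b0R by simp
      have stab: "y \<otimes> a \<in> A" if "y \<in> simple_extension K ?x" "a \<in> A" for y a
        using that
      proof (induction arbitrary: a)
        case zero thus ?case using A by auto
      next
        case (lin k1 k2)
        have R: "k1 \<in> carrier R" "k2 \<in> carrier R" "a \<in> carrier R"
          using lin gen subfieldE(3)[OF subfield_K] A(1) by auto
        have "(k1 \<otimes> ?x \<oplus> k2) \<otimes> a = k1 \<otimes> (b \<otimes> (inv b0 \<otimes> a)) \<oplus> k2 \<otimes> a"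
          using R bR b0R(2) by algebra
        moreover have "b \<otimes> (inv b0 \<otimes> a) \<in> A" using False b lin.prems by blast
        ultimately show ?case using lin A(3,5) by simp
      qed
      obtain a where a: "a \<in> A" "a \<noteq> \<zero>" using A(2) less.prems(2) by blast
      hence aR: "a \<in> carrier R" "inv a \<in> carrier R" "inv a \<otimes> a = \<one>"
        using A(1) inverse by blast+
      \<comment> \<open>Any \<open>z\<close> is an element of \<open>A\<close> times
        \<open>b0\<close>, obtained by moving \<open>a\<close> within \<open>A\<close>. Hence
        \<open>C\<close> would be everything.\<close>
      have "z \<in> C" if z: "z \<in> carrier R" for z
      proof -
        have "(z \<otimes> inv b0 \<otimes> inv a) \<otimes> a \<in> A" using stab gen a(1) z aR b0R by simp
        hence "((z \<otimes> inv b0 \<otimes> inv a) \<otimes> a) \<otimes> b0 \<in> C" using AB b0(1) by blast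
        moreover have "((z \<otimes> inv b0 \<otimes> inv a) \<otimes> a) \<otimes> b0 = z"
          using z aR b0R by (simp add: m_assoc)
        ultimately show ?thesis by simp
      qed
      thus False using C(2) C_props(1) by blast
    qed
    moreover have "b = inv b0 \<otimes> b \<otimes> b0" if "b \<in> B" for b
      using that B(1) b0R by (simp add: m_assoc F.m_comm[of b b0] m_assoc[symmetric] subset_iff)
    ultimately have "B \<subseteq> (\<lambda>v. v \<otimes> b0) ` K" by blast
    moreover have K1: "dimension 1 K ((\<lambda>v. v \<otimes> b0) ` K)"
      using dimension_mult_right[OF assms(1) dimension_one[OF subfield_K]] b0R(1) b0(2) by blast
    ultimately have "dim K B \<le> 1"
      using dim_mono[OF finite_dimensionI[OF K1] less.prems(3)] dim_eqI[OF K1] by simp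
    thus ?thesis using AC by simp
  qed
qed


section \<open>Matching in primitive extensions\<close>

lemma linear_matching_property_if_primitive:
  assumes "field R" and fin: "finite_dimension K (carrier R)"
    and primitive: "\<And>x. \<lbrakk> x \<in> carrier R; x \<notin> K \<rbrakk> \<Longrightarrow> simple_extension K x = carrier R"
  shows "linear_matching_property K"
  unfolding linear_matching_property_def matched_subspaces_def
proof (intro allI impI)
  fix n A B As
  assume "n \<ge> 1" and "dimension n K A \<and> dimension n K B \<and> \<one> \<notin> B" and As: "basis_of K A As"
  hence A: "dimension n K A" and B: "dimension n K B" and one: "\<one> \<notin> B" by auto
  interpret F: field R by (rule assms(1))
  have KR: "K \<subseteq> carrier R" by (rule subfieldE(3)[OF subfield_K])
  have fd: "finite_dimension K V" if "subalgebra K V R" for V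
    using subalbegra_incl_imp_finite_dimension[OF subfield_K fin that] subspace_props(1)[OF that] by blast
  have sA: "subalgebra K A R" and sB: "subalgebra K B R"
    using finite_dimension_imp_subalgebra[OF subfield_K] finite_dimensionI A B by blast+
  have dA: "dim K A = n" and dB: "dim K B = n" using dim_eqI A B by blast+
  note A_props = subspace_props[OF sA] and B_props = subspace_props[OF sB]
  have As_ind: "independent K As" and As_Span: "Span K As = A"
    using As by (auto simp: basis_of_def)
  have len: "length As = n"
    using dimension_is_inj[OF subfield_K dimension_independent[OF As_ind]] A As_Span by simp
  have AsA: "set As \<subseteq> A"
    using Span_base_incl[OF subfield_K independent_in_carrier[OF As_ind]] As_Span by simp
  \<comment> \<open>\<open>A\<close> plays the role of \<open>C\<close> in the Cauchy-Davenport
    inequality. It is proper because \<open>B\<close> has the same dimension and omits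
    \<open>\<one>\<close>.\<close>
  have A_proper: "A \<noteq> carrier R"
  proof
    assume "A = carrier R"
    hence "dim K (carrier R) \<le> dim K B" using dA dB by simp
    hence "B = carrier R" using subspace_eqI[OF fin sB B_props(1)] by blast
    thus False using one by simp
  qed
  \<comment> \<open>\<open>V i\<close> is exactly what the span of all basis vectors of
    \<open>B\<close> except the \<open>i\<close>-th must contain for a matching.\<close>
  define V where "V i = {b \<in> B. As ! i \<otimes> b \<in> A}" for i
  have As_in: "As ! i \<in> A" "As ! i \<in> carrier R" if "i < n" for i
    using AsA A_props(1) that len nth_mem by blast+
  have sV: "subalgebra K (V i) R" if i: "i < n" for i
  proof (rule subspaceI)
    show "V i \<subseteq> carrier R" using B_props(1) by (auto simp: V_def)
    show "\<zero> \<in> V i" using B_props(2) A_props(2) As_in[OF i] by (simp add: V_def)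
    show "x \<oplus> y \<in> V i" if "x \<in> V i" "y \<in> V i" for x y
      using that B_props(1,3) A_props(3) As_in[OF i] by (auto simp: V_def r_distr subset_iff)
    show "k \<otimes> x \<in> V i" if "k \<in> K" "x \<in> V i" for k x
      using that B_props(1,5) A_props(5) As_in[OF i] KR
      by (auto simp: V_def F.m_lcomm subset_iff)
  qed
  have "dim K {x \<in> B. \<forall>i \<in> J. x \<in> V i} + card J \<le> n" if J: "J \<subseteq> {..<n}" for J
  \<comment> \<open>The empty set is treated apart because the inequality needs a nonzero left
    factor, supplied by some \<open>As ! i\<close> with \<open>i \<in> J\<close>.\<close>
  proof (cases "J = {}")
    case True thus ?thesis using dB by simp
  next
    case False
    let ?U = "{x \<in> B. \<forall>i \<in> J. x \<in> V i}"
    have sU: "subalgebra K ?U R" using subspace_Inter[OF sB, of J V] sV J by auto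
    note U = subspace_props[OF sU]
    have "\<one> \<notin> ?U" using one by simp
    \<comment> \<open>Adjoining \<open>\<one>\<close> gains one dimension, which cancels the
      \<open>Suc\<close> of the Cauchy-Davenport inequality.\<close>
    hence dim_U': "dim K (line_extension K \<one> ?U) = Suc (dim K ?U)"
      using dim_line_extension[OF fd[OF sU]] by simp
    let ?U' = "line_extension K \<one> ?U"
    have U': "subalgebra K ?U' R" "\<one> \<in> ?U'"
      using line_extension_subspace[OF sU one_closed] by blast+
    \<comment> \<open>The largest part of \<open>A\<close> that multiplies \<open>?U\<close> into
      \<open>A\<close>. It contains the span of the \<open>As ! i\<close> with
      \<open>i \<in> J\<close>, hence has dimension at least \<open>card J\<close>.\<close>
    define S where "S = {s \<in> A. \<forall>u \<in> ?U. s \<otimes> u \<in> A}"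
    have sS: "subalgebra K S R"
    proof (rule subspaceI)
      show "S \<subseteq> carrier R" using A_props(1) by (auto simp: S_def)
      have "\<zero> \<otimes> u \<in> A" if "u \<in> ?U" for u
      proof -
        have "u \<in> carrier R" using that U(1) by blast
        thus ?thesis using A_props(2) by simp
      qed
      thus "\<zero> \<in> S" using A_props(2) unfolding S_def by blast
    next
      fix s t assume st: "s \<in> S" "t \<in> S"
      have "(s \<oplus> t) \<otimes> u \<in> A" if u: "u \<in> ?U" for u
      proof -
        have "u \<in> carrier R" "s \<in> carrier R" "t \<in> carrier R"
          using u U(1) st A_props(1) unfolding S_def by blast+
        hence "(s \<oplus> t) \<otimes> u = s \<otimes> u \<oplus> t \<otimes> u" by (simp add: l_distr)
        moreover have "s \<otimes> u \<in> A" "t \<otimes> u \<in> A" using st u unfolding S_def by blast+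
        ultimately show ?thesis using A_props(3) by simp
      qed
      moreover have "s \<oplus> t \<in> A" using st A_props(3) unfolding S_def by blast
      ultimately show "s \<oplus> t \<in> S" unfolding S_def by blast
    next
      fix k s assume ks: "k \<in> K" "s \<in> S"
      have "(k \<otimes> s) \<otimes> u \<in> A" if u: "u \<in> ?U" for u
      proof -
        have "u \<in> carrier R" "s \<in> carrier R" "k \<in> carrier R"
          using u U(1) ks A_props(1) KR unfolding S_def by blast+
        hence "(k \<otimes> s) \<otimes> u = k \<otimes> (s \<otimes> u)" by (simp add: m_assoc)
        moreover have "s \<otimes> u \<in> A" using ks u unfolding S_def by blast
        ultimately show ?thesis using A_props(5) ks(1) by simp
      qed
      moreover have "k \<otimes> s \<in> A" using ks A_props(5) unfolding S_def by blast
      ultimately show "k \<otimes> s \<in> S" unfolding S_def by blast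
    qed
    have As_S: "As ! i \<in> S" if "i \<in> J" for i
    proof -
      have "As ! i \<otimes> u \<in> A" if "u \<in> ?U" for u
        using that \<open>i \<in> J\<close> by (simp add: V_def)
      thus ?thesis using As_in(1) J that unfolding S_def by blast
    qed
    have len_nths: "length (nths As J) = card J"
    proof -
      have "{i. i < length As \<and> i \<in> J} = J" using J len by auto
      thus ?thesis by (simp add: length_nths)
    qed
    have "set (nths As J) \<subseteq> S" using As_S by (auto simp: set_nths)
    hence card_S: "card J \<le> dim K S"
      using independent_length_le_dimension[OF subfield_K dimension_dim[OF fd[OF sS]]
          independent_nths[OF As_ind]] len_nths by metis
    have "J \<noteq> {}" "finite J" using False J finite_subset by auto
    hence "dim K S \<noteq> 0" using card_S by auto
    hence S0: "S \<noteq> {\<zero>}" using dim_eqI[OF zero_dim] by metis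
    have U'0: "?U' \<noteq> {\<zero>}" using U'(2) F.one_not_zero by blast
    have "s \<otimes> u \<in> A" if s: "s \<in> S" and u: "u \<in> ?U'" for s u
    proof -
      obtain k v where kv: "k \<in> K" "v \<in> ?U" "u = k \<otimes> \<one> \<oplus> v"
        using u unfolding line_extension_mem_iff by blast
      have R: "k \<in> carrier R" "v \<in> carrier R" "s \<in> carrier R"
        using kv KR U(1) s A_props(1) unfolding S_def by blast+
      \<comment> \<open>The summand from \<open>\<one>\<close> stays in \<open>A\<close> because
        \<open>S\<close> was taken inside \<open>A\<close>.\<close>
      have "s \<otimes> u = k \<otimes> s \<oplus> s \<otimes> v" unfolding kv(3) using R by algebra
      moreover have "s \<in> A" "s \<otimes> v \<in> A" using s kv(2) unfolding S_def by blast+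
      ultimately show ?thesis using A_props(3,5) kv(1) by simp
    qed
    hence "dim K S + dim K ?U' \<le> Suc (dim K A)"
      by (intro linear_cauchy_davenport[OF assms(1) fin primitive sS S0 U'(1) U'0 sA A_proper])
    thus ?thesis using dim_U' card_S dA by simp
  qed
  hence "rado_family n B V" using sV by (auto simp: rado_family_def V_def)
  then obtain Bs where "basis_of K B Bs" "length Bs = n"
    and avoid: "\<And>i. i < n \<Longrightarrow> V i \<subseteq> Span K (take i Bs @ drop (Suc i) Bs)"
    using exists_basis_avoiding[OF B] by metis
  moreover have "matched_bases K A B As Bs"
    unfolding matched_bases_def
  proof (intro ballI allI impI)
    fix b i assume "b \<in> B" "i < length As" "As ! i \<otimes> b \<in> A"
    hence "i < n" "b \<in> V i" using len by (auto simp: V_def)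
    thus "b \<in> Span K (take i Bs @ drop (Suc i) Bs)" using avoid by blast
  qed
  ultimately show "\<exists>Bs. basis_of K B Bs \<and> matched_bases K A B As Bs" by blast
qed

end


section \<open>Extensions without intermediate fields\<close>

text \<open>A factorization of \<open>p\<close> maps to one of \<open>map h p\<close>, and units are
  reflected. This brings minimal polynomials, whose coefficients lie in the copy of the base field,
  back to the base field itself.\<close>

lemma (in ring_hom_ring) pirreducible_map_imp_pirreducible:
  assumes "field R" "field S" and p: "p \<in> carrier (poly_ring R)"
    and irr: "pirreducible\<^bsub>S\<^esub> (h ` carrier R) (map h p)"
  shows "pirreducible\<^bsub>R\<^esub> (carrier R) p"
proof -
  interpret FR: field R by (rule assms(1))
  interpret FS: field S by (rule assms(2))
  let ?hR = "h ` carrier R"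
  have hR: "subfield ?hR S"
    using img_is_subfield(2)[OF FR.carrier_is_subfield] by simp
  have map_carrier: "map h q \<in> carrier (?hR[X]\<^bsub>S\<^esub>)" if "q \<in> carrier (poly_ring R)" for q
    using subfield_polynomial_hom[OF FR.carrier_is_subfield] that by simp
  have units: "map h q \<in> Units (?hR[X]\<^bsub>S\<^esub>) \<longleftrightarrow> q \<in> Units (poly_ring R)"
    if "q \<in> carrier (poly_ring R)" for q
    using that map_carrier[OF that] by (auto simp: FS.univ_poly_units'[OF hR]
        FR.univ_poly_units'[OF FR.carrier_is_subfield])
  have map_mult: "map h (q \<otimes>\<^bsub>poly_ring R\<^esub> r) = map h q \<otimes>\<^bsub>?hR[X]\<^bsub>S\<^esub>\<^esub> map h r"
    if "q \<in> carrier (poly_ring R)" "r \<in> carrier (poly_ring R)" for q r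
  proof -
    have qr: "set q \<subseteq> carrier R" "set r \<subseteq> carrier R"
      using that R.polynomial_incl unfolding univ_poly_carrier[symmetric] by blast+
    interpret UP: domain "poly_ring R"
      using FR.univ_poly_is_domain[OF R.carrier_is_subring] .
    \<comment> \<open>The library's rule for images of products involves \<open>normalize\<close>,
      which does nothing to a list that is already a polynomial.\<close>
    have "polynomial\<^bsub>S\<^esub> ?hR (map h (q \<otimes>\<^bsub>poly_ring R\<^esub> r))"
      using map_carrier[OF UP.m_closed[OF that]] by (simp add: univ_poly_carrier)
    thus ?thesis
      using poly_mult_hom'[OF qr] S.normalize_polynomial by (simp add: univ_poly_mult)
  qed
  note E = FS.pirreducibleE[OF subfieldE(1)[OF hR] map_carrier[OF p] irr]
  show ?thesis
  proof (rule FR.pirreducibleI[OF R.carrier_is_subring p])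
    show "p \<noteq> []" using E(1) by simp
    show "p \<notin> Units (poly_ring R)" using E(2) units p by simp
    fix q r assume qr: "q \<in> carrier (poly_ring R)" "r \<in> carrier (poly_ring R)"
      "p = q \<otimes>\<^bsub>poly_ring R\<^esub> r"
    hence "map h p = map h q \<otimes>\<^bsub>?hR[X]\<^bsub>S\<^esub>\<^esub> map h r" using map_mult by simp
    thus "q \<in> Units (poly_ring R) \<or> r \<in> Units (poly_ring R)"
      using E(3)[OF map_carrier map_carrier] units qr by blast
  qed
qed

text \<open>Coefficients are pulled back one by one. The leading one stays nonzero because
  \<open>h\<close> sends zero to zero.\<close>

lemma (in ring_hom_ring) exists_poly_preimage:
  assumes "field R" "field S" and q: "q \<in> carrier ((h ` carrier R)[X]\<^bsub>S\<^esub>)"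
  obtains p where "p \<in> carrier (poly_ring R)" "map h p = q"
proof -
  interpret FR: field R by (rule assms(1))
  interpret FS: field S by (rule assms(2))
  let ?g = "inv_into (carrier R) h"
  have q': "set q \<subseteq> h ` carrier R" "q \<noteq> [] \<Longrightarrow> lead_coeff q \<noteq> \<zero>\<^bsub>S\<^esub>"
    using q unfolding univ_poly_carrier[symmetric] polynomial_def by auto
  have map_g: "map h (map ?g q) = q"
    using q'(1) by (auto simp: f_inv_into_f subset_iff intro!: map_idI)
  have set_g: "set (map ?g q) \<subseteq> carrier R"
    using q'(1) by (auto intro!: inv_into_into)
  have "lead_coeff (map ?g q) \<noteq> \<zero>" if "map ?g q \<noteq> []"
  proof
    assume "lead_coeff (map ?g q) = \<zero>"
    hence "h (lead_coeff (map ?g q)) = \<zero>\<^bsub>S\<^esub>" by simp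
    moreover have "h (lead_coeff (map ?g q)) = lead_coeff q"
      using that map_g by (metis list.map_sel(1))
    ultimately show False using q'(2) that by simp
  qed
  hence "map ?g q \<in> carrier (poly_ring R)"
    using set_g unfolding univ_poly_carrier[symmetric] polynomial_def by auto
  thus ?thesis using that map_g by blast
qed

section \<open>The quotient by an irreducible polynomial of least degree\<close>

theorem theorem2p3:
  fixes K :: "('a, 'm) ring_scheme"
  assumes "field K"
    and "\<not> algebraically_closed K"
  shows "minimal_linear_matching_property K"
proof -
  interpret K: field K by (rule assms(1))
  define P where "P q \<longleftrightarrow> q \<in> carrier (poly_ring K) \<and> pirreducible\<^bsub>K\<^esub> (carrier K) q \<and> degree q > 1"
    for q
  have "\<exists>q. P q"
  proof (rule ccontr)
    assume "\<not> (\<exists>q. P q)"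
    hence "K.splitted p" if "p \<in> carrier (poly_ring K)" for p
      using K.trivial_factors_imp_splitted[OF that] by (auto simp: P_def not_less)
    thus False using K.algebraically_closedI' assms(2) by blast
  qed
  \<comment> \<open>Least degree makes every element outside the copy of \<open>K\<close> a
    generator: no irreducible polynomial has degree strictly between 1 and
    \<open>degree p\<close>.\<close>
  then obtain p where "P p" and least: "\<And>q. P q \<Longrightarrow> degree p \<le> degree q"
    using ex_has_least_nat[of P _ degree] by blast
  hence p: "p \<in> carrier (poly_ring K)" "pirreducible\<^bsub>K\<^esub> (carrier K) p" "degree p > 1"
    by (auto simp: P_def)
  define L where "L = Rupt\<^bsub>K\<^esub> (carrier K) p"
  \<comment> \<open>The embedding of \<open>K\<close> into the quotient, by residue classes of
    constant polynomials.\<close>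
  define h where "h = K.rupture_surj (carrier K) p \<circ> K.poly_of_const"
  have "field L"
    using K.rupture_is_field_iff_pirreducible[OF K.carrier_is_subfield p(1)] p(2) by (simp add: L_def)
  then interpret L: field L .
  have h: "h \<in> ring_hom K L"
    using K.rupture_surj_norm_is_hom[OF K.carrier_is_subring p(1)] by (simp add: L_def h_def)
  interpret h: ring_hom_ring K L h
    using ring_hom_ringI2[OF K.ring_axioms L.ring_axioms h] .
  let ?hK = "h ` carrier K"
  have hK: "subfield ?hK L"
    using h.img_is_subfield(2)[OF K.carrier_is_subfield] by simp
  interpret E: embedded_algebra ?hK L
    using hK L.ring_axioms by (rule embedded_algebra.intro)
  have dim_L: "L.dimension (degree p) ?hK (carrier L)"
    using K.rupture_dimension[OF K.carrier_is_subfield p(1)] p(3)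
    by (simp add: L_def h_def image_comp)
  have fin: "L.finite_dimension ?hK (carrier L)" using L.finite_dimensionI[OF dim_L] .
  have proper: "?hK \<noteq> carrier L"
  proof
    assume "?hK = carrier L"
    hence "L.dimension 1 ?hK (carrier L)" using L.dimension_one[OF hK] by simp
    hence "degree p = 1" by (rule L.dimension_is_inj[OF hK dim_L])
    thus False using p(3) by simp
  qed
  have primitive: "L.simple_extension ?hK x = carrier L" if x: "x \<in> carrier L" "x \<notin> ?hK" for x
  proof -
    let ?F = "L.simple_extension ?hK x" and ?q = "L.Irr ?hK x"
    have alg: "(L.algebraic over ?hK) x"
      using L.finite_dimension_imp_algebraic[OF hK L.carrier_is_subring fin x(1)] .
    have dim_F: "L.dimension (degree ?q) ?hK ?F"
      using L.dimension_simple_extension[OF hK x(1) alg] .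
    have sub_F: "subalgebra ?hK ?F L"
      using L.finite_dimension_imp_subalgebra[OF hK L.finite_dimensionI[OF dim_F]] .
    note q = L.IrrE(1,2)[OF hK x(1) alg]
    \<comment> \<open>Degree 1 would make \<open>?F\<close> one-dimensional, hence equal to
      \<open>?hK\<close>, which omits \<open>x\<close>.\<close>
    have "degree ?q \<noteq> 1"
    proof
      assume "degree ?q = 1"
      hence "L.dim ?hK ?F \<le> L.dim ?hK ?hK"
        using E.dim_eqI[OF dim_F] E.dim_eqI[OF L.dimension_one[OF hK]] by simp
      hence "?hK = ?F"
        using E.subspace_eqI[OF L.finite_dimensionI[OF dim_F]]
          L.finite_dimension_imp_subalgebra[OF hK L.finite_dimensionI[OF L.dimension_one[OF hK]]]
          L.simple_extension_incl[OF subfieldE(3)[OF hK] x(1)] by blast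
      thus False using L.simple_extension_mem[OF subfieldE(1)[OF hK] x(1)] x(2) by simp
    qed
    hence deg: "degree ?q > 1" using L.pirreducible_degree[OF hK q] by simp
    \<comment> \<open>\<open>p\<close> is minimal among polynomials over \<open>K\<close>, so
      \<open>?q\<close> must be pulled back along \<open>h\<close> before degrees can be
      compared.\<close>
    obtain r where r: "r \<in> carrier (poly_ring K)" "map h r = ?q"
      using h.exists_poly_preimage[OF assms(1) \<open>field L\<close> q(1)] .
    have deg_r: "degree r = degree ?q" using r(2) by (metis length_map)
    have "pirreducible\<^bsub>K\<^esub> (carrier K) r"
      by (rule h.pirreducible_map_imp_pirreducible[OF assms(1) \<open>field L\<close> r(1)])
        (unfold r(2), rule q(2))
    hence "P r" using r(1) deg deg_r by (simp add: P_def)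
    hence "degree p \<le> degree ?q" using least deg_r by metis
    \<comment> \<open>These two degrees are the dimensions of \<open>L\<close> and \<open>?F\<close>
      over \<open>?hK\<close>, so \<open>?F\<close> is all of \<open>L\<close>.\<close>
    hence "L.dim ?hK (carrier L) \<le> L.dim ?hK ?F"
      using E.dim_eqI[OF dim_L] E.dim_eqI[OF dim_F] by simp
    thus ?thesis
      using E.subspace_eqI[OF fin sub_F] L.simple_extension_in_carrier[OF subfieldE(3)[OF hK] x(1)]
      by blast
  qed
  have "L.linear_matching_property ?hK"
    using E.linear_matching_property_if_primitive[OF \<open>field L\<close> fin primitive] .
  moreover have "finite_field_extension K h L"
    using assms(1) \<open>field L\<close> h fin by (simp add: finite_field_extension_def)
  ultimately show ?thesis
    unfolding minimal_linear_matching_property_def using proper by blast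
qed

end
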